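(* Let $n, N \ge 1$ be integers, let $x^1,\dots,x^N \in \mathbb{R}^n$ and $y^1,\dots,y^N \in \mathbb{R}$ be given, and let $a_0, a_1, b_0, b_1 \in \mathbb{R}$ be fixed. Let $$D = \left\{ (\mathbf{W}, b) \in \mathbb{R}^{1\times n} \times \mathbb{R} \;:\; b_0 + b_1(\mathbf{W}x^i + b) > 0 \text{ for all } i = 1,\dots,N \right\}.$$ Then the function $L : D \to \mathbb{R}$ defined by $$L(\mathbf{W}, b) = \max_{i \in \{1,\dots,N\}} \left| y^i - \frac{a_0 + a_1(\mathbf{W}x^i + b)}{b_0 + b_1(\mathbf{W}x^i + b)} \right|$$ is quasiconvex on $D$.
   Context: Here $\mathbf{W}$ is a row vector of $n$ real weights, each $x^i$ is a column vector in $\mathbb{R}^n$, so $\mathbf{W}x^i \in \mathbb{R}$, and $b \in \mathbb{R}$ is a bias term (distinct from the fixed coefficients $b_0, b_1$). The variables of $L$ are $(\mathbf{W}, b)$; the data $(x^i, y^i)$ and the coefficients $a_0,a_1,b_0,b_1$ are fixed. A real-valued function $f$ defined on a convex subset $D$ of a real vector space is quasiconvex if for every $\alpha \in \mathbb{R}$ the sublevel set $\{u \in D : f(u) \le \alpha\}$ is convex; equivalently, $f(\lambda u + (1-\lambda) v) \le \max\{f(u), f(v)\}$ for all $u, v \in D$ and $\lambda \in [0,1]$. *)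

theory Defs
  imports "HOL-Analysis.Analysis"
begin

(* As for convex_on, convexity of the domain is part of the notion. *)
definition quasiconvex_on :: "'a::real_vector set \<Rightarrow> ('a \<Rightarrow> real) \<Rightarrow> bool" where
  "quasiconvex_on D f \<longleftrightarrow> convex D \<and> (\<forall>\<alpha>. convex {u \<in> D. f u \<le> \<alpha>})"

(* The row vector W is a 1 x n matrix; W *v v has type real^1, hence the "$ 1". *)
definition affine_output :: "(real^'n^1) \<times> real \<Rightarrow> real^'n \<Rightarrow> real" where
  "affine_output = (\<lambda>(W, b) v. (W *v v) $ 1 + b)"

definition loss_domain ::
  "nat \<Rightarrow> (nat \<Rightarrow> real^'n) \<Rightarrow> real \<Rightarrow> real \<Rightarrow> ((real^'n^1) \<times> real) set" where
  "loss_domain N x b0 b1 = {u. \<forall>i\<in>{1..N}. b0 + b1 * affine_output u (x i) > 0}"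

(* Max is meaningful only for N >= 1. *)
definition loss ::
  "nat \<Rightarrow> (nat \<Rightarrow> real^'n) \<Rightarrow> (nat \<Rightarrow> real) \<Rightarrow> real \<Rightarrow> real \<Rightarrow> real \<Rightarrow> real
    \<Rightarrow> (real^'n^1) \<times> real \<Rightarrow> real" where
  "loss N x y a0 a1 b0 b1 u =
    Max ((\<lambda>i. \<bar>y i - (a0 + a1 * affine_output u (x i)) / (b0 + b1 * affine_output u (x i))\<bar>) ` {1..N})"

end

(* For a fixed sample, the sublevel condition on the error |y - p/q| is, after clearing the positive
   denominator q, a pair of inequalities that are affine in the scalar output t. It therefore cuts
   out an interval of outputs, whose preimage under the linear map from (W, b) to the output is convex. *)
theory Submission
  imports Defs
begin

text \<open>The bias is one of the variables, so the output is jointly linear in the pair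
  \<open>(W, b)\<close>, with no constant term.\<close>

lemma linear_affine_output: "linear (\<lambda>u. affine_output u v)"
  by (rule linearI)
    (auto simp: affine_output_def split_beta matrix_vector_mult_add_rdistrib
      scaleR_matrix_vector_assoc[symmetric] algebra_simps)

lemma convex_positive_affine: "convex {t::real. 0 < c + d * t}"
proof -
  \<comment> \<open>On the reals the inner product is multiplication, which gives the form of the
    library's halfspace facts.\<close>
  have "{t. 0 < c + d * t} = {t. d \<bullet> t > - c}" by auto
  then show ?thesis by (simp only: convex_halfspace_gt)
qed

lemma convex_nonneg_affine: "convex {t::real. 0 \<le> c + d * t}"
proof -
  have "{t. 0 \<le> c + d * t} = {t. d \<bullet> t \<ge> - c}" by auto
  then show ?thesis by (simp only: convex_halfspace_ge)
qed

text \<open>Positivity of the denominator is part of the set, since clearing the fraction keeps the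
  direction of the inequalities only there.\<close>

lemma convex_linear_fractional_error_sublevel:
  fixes a0 a1 b0 b1 y \<alpha> :: real
  shows "convex {t. 0 < b0 + b1 * t \<and> \<bar>y - (a0 + a1 * t) / (b0 + b1 * t)\<bar> \<le> \<alpha>}"
proof -
  \<comment> \<open>The last two sets are \<open>(y - \<alpha>) * q \<le> p\<close> and
    \<open>p \<le> (y + \<alpha>) * q\<close> for \<open>p = a0 + a1 * t\<close> and
    \<open>q = b0 + b1 * t\<close>, sorted by powers of \<open>t\<close>.\<close>
  have "{t. 0 < b0 + b1 * t \<and> \<bar>y - (a0 + a1 * t) / (b0 + b1 * t)\<bar> \<le> \<alpha>} =
    {t. 0 < b0 + b1 * t} \<inter>
    {t. 0 \<le> (a0 - (y - \<alpha>) * b0) + (a1 - (y - \<alpha>) * b1) * t} \<inter>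
    {t. 0 \<le> ((y + \<alpha>) * b0 - a0) + ((y + \<alpha>) * b1 - a1) * t}"
  proof -
    have "\<bar>y - p / q\<bar> \<le> \<alpha> \<longleftrightarrow> (y - \<alpha>) * q \<le> p \<and> p \<le> (y + \<alpha>) * q" if "0 < q" for p q :: real
      using that by (auto simp: abs_le_iff field_simps)
    then show ?thesis by (auto simp: algebra_simps)
  qed
  then show ?thesis
    by (simp only: convex_Int convex_positive_affine convex_nonneg_affine)
qed

theorem theorem1:
  fixes N :: nat and x :: "nat \<Rightarrow> real^'n" and y :: "nat \<Rightarrow> real"
    and a0 a1 b0 b1 :: real
  assumes "N \<ge> 1"
  shows "quasiconvex_on (loss_domain N x b0 b1) (loss N x y a0 a1 b0 b1)"
proof -
  have "loss_domain N x b0 b1 =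
    (\<Inter>i\<in>{1..N}. (\<lambda>u. affine_output u (x i)) -` {t. 0 < b0 + b1 * t})"
    by (auto simp: loss_domain_def)
  then have "convex (loss_domain N x b0 b1)"
    by (simp only: convex_INT convex_linear_vimage linear_affine_output convex_positive_affine)
  moreover have "convex {u \<in> loss_domain N x b0 b1. loss N x y a0 a1 b0 b1 u \<le> \<alpha>}" for \<alpha>
  proof -
    have "{u \<in> loss_domain N x b0 b1. loss N x y a0 a1 b0 b1 u \<le> \<alpha>} =
      (\<Inter>i\<in>{1..N}. (\<lambda>u. affine_output u (x i)) -`
        {t. 0 < b0 + b1 * t \<and> \<bar>y i - (a0 + a1 * t) / (b0 + b1 * t)\<bar> \<le> \<alpha>})"
      \<comment> \<open>A maximum is at most \<alpha> iff every entry is; this needs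
        \<open>{1..N}\<close> nonempty, hence \<open>N \<ge> 1\<close>.\<close>
      using assms by (auto simp: loss_domain_def loss_def)
    then show ?thesis
      by (simp only: convex_INT convex_linear_vimage linear_affine_output
          convex_linear_fractional_error_sublevel)
  qed
  ultimately show ?thesis by (simp add: quasiconvex_on_def)
qed

end
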